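(* Let $\mathfrak c=2^{\aleph_0}$ and suppose that $2^{<\mathfrak c}=\mathfrak c$. Then the following are equivalent: 1. There is a Borel function $F:2^\omega\times 2^\omega\to 2^\omega$ which is universal. 2. Every subset of $2^\omega\times 2^\omega$ is in the $\sigma$-algebra generated by the family $\mathcal R$ of abstract rectangles. Furthermore, for every $\alpha$ with $1\le\alpha<\omega_1$: $\mathcal P(2^\omega\times 2^\omega)=\mathbf\Sigma^0_\alpha(\mathcal R)$ if and only if there is a universal Borel function $F:2^\omega\times2^\omega\to2^\omega$ at the $\alpha$-level.
   Context: A function $F:X\times X\to X$ is universal iff for every $G:X\times X\to X$ there is $g:X\to X$ with $G(x,y)=F(g(x),g(y))$ for all $x,y\in X$. The abstract rectangles are $\mathcal R=\{A\times B : A,B\subseteq 2^\omega\}$ (arbitrary subsets). Define $\mathbf\Sigma^0_0(\mathcal R)=\mathbf\Pi^0_0(\mathcal R)$ to be the finite Boolean combinations of sets from $\mathcal R$; for $0<\alpha<\omega_1$, $\mathbf\Sigma^0_\alpha(\mathcal R)$ is the family of countable unions of sets from $\bigcup_{\beta<\alpha}\mathbf\Pi^0_\beta(\mathcal R)$ and $\mathbf\Pi^0_\alpha(\mathcal R)$ the family of countable intersections of sets from $\bigcup_{\beta<\alpha}\mathbf\Sigma^0_\beta(\mathcal R)$. A Borel function $F:2^\omega\times2^\omega\to2^\omega$ is at the $\alpha$-level iff for every $n<\omega$ the set $\{(u,v): F(u,v)(n)=1\}$ is $\mathbf\Sigma^0_\alpha$ in the Borel hierarchy of $2^\omega\times 2^\omega$.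 $2^{<\mathfrak c}=\sup_{\lambda<\mathfrak c}2^\lambda$, over cardinals $\lambda$. *)

theory Defs
  imports "HOL-Analysis.Analysis" "HOL-Library.Countable_Set_Type"
begin

unbundle cardinal_syntax

section \<open>The ordinals below the first uncountable ordinal\<close>

text \<open>A cardinal is an initial ordinal, so the successor cardinal of \<^const>\<open>natLeq\<close> is a well-order
  of type $\omega_1$, and its elements represent the ordinals $\alpha < \omega_1$.\<close>

typedef omega1 = "Field (cardSuc natLeq)"
proof -
  have "Field (cardSuc natLeq) \<noteq> {}"
    using Field_cardSuc_not_empty natLeq_Card_order by blast
  then show ?thesis by blast
qed

instantiation omega1 :: wellorder
begin

definition less_eq_omega1 :: "omega1 \<Rightarrow> omega1 \<Rightarrow> bool" where
  "a \<le> b \<longleftrightarrow> (Rep_omega1 a, Rep_omega1 b) \<in> cardSuc natLeq"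

definition less_omega1 :: "omega1 \<Rightarrow> omega1 \<Rightarrow> bool" where
  "(a :: omega1) < b \<longleftrightarrow> a \<le> b \<and> a \<noteq> b"

instance
proof -
  have wo: "Well_order (cardSuc natLeq)"
    by (rule cardSuc_Well_order[OF natLeq_Card_order])
  then have refl: "refl_on (Field (cardSuc natLeq)) (cardSuc natLeq)"
    and trans: "trans (cardSuc natLeq)" and anti: "antisym (cardSuc natLeq)"
    and total: "total_on (Field (cardSuc natLeq)) (cardSuc natLeq)"
    and wf: "wf (cardSuc natLeq - Id)"
    unfolding well_order_on_def linear_order_on_def partial_order_on_def preorder_on_def by blast+
  have less_iff: "a < b \<longleftrightarrow> (Rep_omega1 a, Rep_omega1 b) \<in> cardSuc natLeq - Id" for a b
    by (auto simp: less_omega1_def less_eq_omega1_def Rep_omega1_inject)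
  have eq: "a = b" if "a \<le> b" "b \<le> a" for a b :: omega1
    using that antisymD[OF anti] by (metis less_eq_omega1_def Rep_omega1_inject)
  have le_refl: "a \<le> a" for a :: omega1
    using refl_onD[OF refl Rep_omega1] by (simp add: less_eq_omega1_def)
  show "OFCLASS(omega1, wellorder_class)"
  proof
    fix a b c :: omega1
    show "a \<le> b \<Longrightarrow> b \<le> a \<Longrightarrow> a = b"
      by (rule eq)
    show "(a < b) = (a \<le> b \<and> \<not> b \<le> a)"
      using eq le_refl by (metis less_omega1_def)
    show "a \<le> a"
      by (rule le_refl)
    show "a \<le> b \<Longrightarrow> b \<le> c \<Longrightarrow> a \<le> c"
      unfolding less_eq_omega1_def using transD[OF trans] .
    show "a \<le> b \<or> b \<le> a"
      using total Rep_omega1[of a] Rep_omega1[of b] le_refl[of a]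
      unfolding less_eq_omega1_def total_on_def by metis
  next
    fix P :: "omega1 \<Rightarrow> bool" and a
    assume step: "\<And>x. (\<And>y. y < x \<Longrightarrow> P y) \<Longrightarrow> P x"
    have "wf (inv_image (cardSuc natLeq - Id) Rep_omega1)"
      by (rule wf_inv_image[OF wf])
    then show "P a"
    proof (induction a rule: wf_induct_rule)
      case (less x)
      show ?case
        by (rule step, rule less) (simp only: in_inv_image less_iff)
    qed
  qed
qed

end

lemma countable_initial_segment_omega1: "countable {..<a :: omega1}"
proof -
  have "|underS (cardSuc natLeq) (Rep_omega1 a)| <o cardSuc natLeq"
    by (rule card_of_underS[OF cardSuc_Card_order[OF natLeq_Card_order] Rep_omega1])
  then have "|underS (cardSuc natLeq) (Rep_omega1 a)| \<le>o natLeq"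
    using cardSuc_ordLeq_ordLess card_of_Card_order natLeq_Card_order by blast
  then have "countable (underS (cardSuc natLeq) (Rep_omega1 a))"
    by (simp add: countable_card_le_natLeq)
  moreover have "Rep_omega1 ` {..<a} \<subseteq> underS (cardSuc natLeq) (Rep_omega1 a)"
    by (auto simp: underS_def less_omega1_def less_eq_omega1_def Rep_omega1_inject)
  ultimately have "countable (Rep_omega1 ` {..<a})"
    using countable_subset by blast
  then show ?thesis
    by (rule countable_image_inj_on) (auto simp: inj_on_def Rep_omega1_inject)
qed

lemma uncountable_omega1: "uncountable (UNIV :: omega1 set)"
proof
  assume "countable (UNIV :: omega1 set)"
  then have "countable (range Rep_omega1)" by (rule countable_image)
  then have "|Field (cardSuc natLeq)| \<le>o natLeq"
    using type_definition.Rep_range[OF type_definition_omega1]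
    by (simp add: countable_card_le_natLeq)
  moreover have "|Field (cardSuc natLeq)| =o cardSuc natLeq"
    by (rule card_of_Field_ordIso[OF cardSuc_Card_order[OF natLeq_Card_order]])
  ultimately have "cardSuc natLeq \<le>o natLeq"
    using ordIso_ordLeq_trans ordIso_symmetric by blast
  then show False
    using cardSuc_greater[OF natLeq_Card_order] not_ordLeq_ordLess by blast
qed

instantiation omega1 :: zero_neq_one
begin

definition zero_omega1 :: omega1 where "(0 :: omega1) = (LEAST a. True)"

definition one_omega1 :: omega1 where "(1 :: omega1) = (LEAST a. 0 < a)"

instance
proof
  have min: "(0 :: omega1) \<le> a" for a
    unfolding zero_omega1_def by (rule Least_le) simp
  have "\<exists>a :: omega1. 0 < a"
  proof (rule ccontr)
    assume "\<not> (\<exists>a :: omega1. 0 < a)"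
    then have "a = 0" for a :: omega1
      using min[of a] by (metis less_omega1_def)
    then have "UNIV = {0 :: omega1}" by blast
    then show False
      using uncountable_omega1 by (metis countable_finite finite.emptyI finite_insert)
  qed
  then have "(0 :: omega1) < 1"
    unfolding one_omega1_def by (rule LeastI_ex)
  then show "(0 :: omega1) \<noteq> 1" by simp
qed

end

section \<open>Cardinal arithmetic\<close>

text \<open>\<open>is_two_power_below \<kappa> s\<close>: the cardinal \<open>s\<close> is $2^{<\kappa} = \sup_{\lambda<\kappa} 2^\lambda$.
  Every cardinal below \<open>\<kappa> :: 'a rel\<close> has an isomorphic copy of type \<open>'a rel\<close>, and every
  cardinal below \<open>s :: 'b rel\<close> one of type \<open>'b rel\<close>, so the quantifiers range over enough cardinals.\<close>

definition is_two_power_below :: "'a rel \<Rightarrow> 'b rel \<Rightarrow> bool" where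
  "is_two_power_below \<kappa> s \<longleftrightarrow>
     Card_order s \<and>
     (\<forall>l :: 'a rel. Card_order l \<and> l <o \<kappa> \<longrightarrow> ctwo ^c l \<le>o s) \<and>
     (\<forall>t :: 'b rel. Card_order t \<and> (\<forall>l :: 'a rel. Card_order l \<and> l <o \<kappa> \<longrightarrow> ctwo ^c l \<le>o t)
        \<longrightarrow> s \<le>o t)"

definition continuum :: "(nat \<Rightarrow> bool) rel" where
  "continuum = ctwo ^c natLeq"

section \<open>Universal functions and abstract rectangles\<close>

text \<open>The Cantor space $2^\omega$, with the product topology of the discrete topology on \<^typ>\<open>bool\<close>;
  the digit 1 is \<^const>\<open>True\<close>.\<close>

type_synonym cantor = "nat \<Rightarrow> bool"

definition universal :: "('a \<times> 'a \<Rightarrow> 'a) \<Rightarrow> bool" where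
  "universal F \<longleftrightarrow> (\<forall>G :: 'a \<times> 'a \<Rightarrow> 'a. \<exists>g :: 'a \<Rightarrow> 'a. \<forall>x y. G (x, y) = F (g x, g y))"

definition abstract_rectangles :: "(cantor \<times> cantor) set set" where
  "abstract_rectangles = {A \<times> B | A B. True}"

inductive_set boolean_combinations :: "'a set set \<Rightarrow> 'a set set" for R where
  base: "S \<in> R \<Longrightarrow> S \<in> boolean_combinations R"
| compl: "S \<in> boolean_combinations R \<Longrightarrow> - S \<in> boolean_combinations R"
| union: "S \<in> boolean_combinations R \<Longrightarrow> T \<in> boolean_combinations R
    \<Longrightarrow> S \<union> T \<in> boolean_combinations R"
| inter: "S \<in> boolean_combinations R \<Longrightarrow> T \<in> boolean_combinations R
    \<Longrightarrow> S \<inter> T \<in> boolean_combinations R"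

function Sigma_level :: "'a set set \<Rightarrow> omega1 \<Rightarrow> 'a set set"
  and Pi_level :: "'a set set \<Rightarrow> omega1 \<Rightarrow> 'a set set"
where
  "Sigma_level R \<alpha> = (if \<alpha> = 0 then boolean_combinations R
     else {\<Union>C | C. countable C \<and> C \<subseteq> (\<Union>\<beta>\<in>{..<\<alpha>}. Pi_level R \<beta>)})"
| "Pi_level R \<alpha> = (if \<alpha> = 0 then boolean_combinations R
     else {\<Inter>C | C. countable C \<and> C \<subseteq> (\<Union>\<beta>\<in>{..<\<alpha>}. Sigma_level R \<beta>)})"
  by pat_completeness auto
termination
  by (relation "inv_image {(a, b). a < b} (case_sum snd snd)") (auto simp: wf)

declare Sigma_level.simps [simp del] Pi_level.simps [simp del]

section \<open>The Borel hierarchy\<close>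

text \<open>\<open>borel_Sigma \<alpha>\<close> is $\mathbf\Sigma^0_\alpha$ for $1 \le \alpha < \omega_1$, where
  $\mathbf\Sigma^0_1$ consists of the open sets and $\mathbf\Pi^0_\alpha$ of the complements of
  $\mathbf\Sigma^0_\alpha$ sets. The value at 0 has no significance.\<close>

function borel_Sigma :: "omega1 \<Rightarrow> ('a :: topological_space) set set"
  and borel_Pi :: "omega1 \<Rightarrow> 'a set set"
where
  "borel_Sigma \<alpha> = (if \<alpha> \<le> 1 then {U. open U}
     else {\<Union>C | C. countable C \<and> C \<subseteq> (\<Union>\<beta>\<in>{1..<\<alpha>}. borel_Pi \<beta>)})"
| "borel_Pi \<alpha> = {S. - S \<in> borel_Sigma \<alpha>}"
  by pat_completeness auto
termination
  by (relation "inv_image ({(a, b). a < b} <*lex*> {(m, n). m < n})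
        (case_sum (\<lambda>\<alpha>. (\<alpha>, 0 :: nat)) (\<lambda>\<alpha>. (\<alpha>, 1)))") (auto simp: wf)

declare borel_Sigma.simps [simp del] borel_Pi.simps [simp del]

definition at_level :: "omega1 \<Rightarrow> (cantor \<times> cantor \<Rightarrow> cantor) \<Rightarrow> bool" where
  "at_level \<alpha> F \<longleftrightarrow> (\<forall>n. {(u, v). F (u, v) n} \<in> borel_Sigma \<alpha>)"

end

theory Submission
  imports Defs
begin

text \<open>The $\mathbf\Sigma^0_\alpha$ sets over the abstract rectangles, and likewise the members of the
  $\sigma$-algebra they generate, are exactly the sets $(h \times h)^{-1}(B)$ with \<open>h\<close> an arbitrary self-map of
  $2^\omega$ and \<open>B\<close> a $\mathbf\Sigma^0_\alpha$ (respectively Borel) set: countably many maps \<open>h\<close> can be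
  merged into one, from which each of them is recovered by a continuous map. A universal Borel \<open>F\<close>
  therefore exhibits every plane set as such a preimage. Conversely, $2^{<\mathfrak c} = \mathfrak c$
  yields a universal function \<open>E\<close> with no definability; if every plane set is such a preimage, then
  the countably many digits of \<open>E\<close> are preimages of Borel sets under one common $h \times h$, so
  \<open>E (x, y) = F (h x, h y)\<close> with \<open>F\<close> Borel, and \<open>F\<close> is again universal.\<close>

section \<open>Countable ordinals\<close>

lemma zero_le_omega1: "(0 :: omega1) \<le> a"
  unfolding zero_omega1_def by (rule Least_le) simp

lemma less_one_omega1_iff: "(a :: omega1) < 1 \<longleftrightarrow> a = 0"
proof
  assume "a < 1"
  then have "\<not> 0 < a"
    unfolding one_omega1_def by (rule not_less_Least)
  then show "a = 0"
    using zero_le_omega1[of a] by simp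
next
  assume "a = 0"
  then show "a < 1"
    using zero_le_omega1[of 1] zero_neq_one by (metis order_le_less)
qed

lemma one_le_omega1_iff: "1 \<le> a \<longleftrightarrow> (a :: omega1) \<noteq> 0"
  using less_one_omega1_iff not_le by metis

section \<open>The Cantor space\<close>

text \<open>Gives \<open>cantor\<close>, a countable power of \<open>bool\<close>, a countable
  basis; open plane sets then become countable unions of rectangles.\<close>

instance bool :: second_countable_topology
proof
  have "open = generate_topology (UNIV :: bool set set)"
    by (auto simp: fun_eq_iff open_discrete intro: generate_topology.Basis)
  then show "\<exists>B :: bool set set. countable B \<and> open = generate_topology B"
    by (intro exI[of _ UNIV]) simp
qed

text \<open>Interleaving along the pairing of \<omega> x \<omega> with \<omega>. The n-th point is
  recovered by the continuous map \<open>proj n\<close>, which is what lets arbitrary maps be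
  combined.\<close>

definition merge :: "(nat \<Rightarrow> cantor) \<Rightarrow> cantor" where
  "merge f = (\<lambda>k. case prod_decode k of (n, m) \<Rightarrow> f n m)"

definition proj :: "nat \<Rightarrow> cantor \<Rightarrow> cantor" where
  "proj n u = (\<lambda>m. u (prod_encode (n, m)))"

lemma proj_merge [simp]: "proj n (merge f) = f n"
  by (simp add: proj_def merge_def)

lemma continuous_proj: "continuous_on UNIV (proj n)"
  unfolding proj_def by (intro continuous_on_coordinatewise_then_product continuous_on_product_coordinates)

lemma continuous_map_prod:
  assumes "continuous_on UNIV f" "continuous_on UNIV g"
  shows "continuous_on UNIV (map_prod f g)"
  unfolding map_prod_def split_beta
  by (intro continuous_on_Pair continuous_on_compose2[OF assms(1)] continuous_on_compose2[OF assms(2)]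
      continuous_on_fst continuous_on_snd continuous_on_id) auto

section \<open>The two hierarchies\<close>

lemma borel_Pi_iff: "S \<in> borel_Pi \<alpha> \<longleftrightarrow> - S \<in> borel_Sigma \<alpha>"
  by (simp add: borel_Pi.simps)

lemma borel_Sigma_one: "borel_Sigma 1 = {U. open U}"
  by (subst borel_Sigma.simps) simp

lemma borel_Sigma_gt_one:
  assumes "1 < \<alpha>"
  shows "borel_Sigma \<alpha> = {\<Union>C | C. countable C \<and> C \<subseteq> (\<Union>\<beta>\<in>{1..<\<alpha>}. borel_Pi \<beta>)}"
  by (subst borel_Sigma.simps, rule if_not_P) (use assms in simp)

lemma borel_Sigma_vimage:
  fixes f :: "'a :: topological_space \<Rightarrow> 'b :: topological_space"
  assumes f: "continuous_on UNIV f"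
  shows "B \<in> borel_Sigma \<alpha> \<Longrightarrow> f -` B \<in> borel_Sigma \<alpha>"
proof (induction \<alpha> arbitrary: B rule: less_induct)
  case (less \<alpha>)
  show ?case
  proof (cases "\<alpha> \<le> 1")
    case True
    with less.prems f show ?thesis
      by (simp add: borel_Sigma.simps open_vimage)
  next
    case False
    then have \<alpha>: "1 < \<alpha>" by simp
    obtain C where C: "B = \<Union>C" "countable C" "C \<subseteq> (\<Union>\<beta>\<in>{1..<\<alpha>}. borel_Pi \<beta>)"
      using less.prems unfolding borel_Sigma_gt_one[OF \<alpha>] by blast
    have "f -` D \<in> borel_Pi \<beta>" if "\<beta> < \<alpha>" "D \<in> borel_Pi \<beta>" for \<beta> D
      using less.IH[OF that(1), of "- D"] that(2) by (simp add: borel_Pi_iff vimage_Compl)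
    then have "vimage f ` C \<subseteq> (\<Union>\<beta>\<in>{1..<\<alpha>}. borel_Pi \<beta>)"
      using C(3) by fastforce
    moreover have "f -` B = \<Union>(vimage f ` C)" "countable (vimage f ` C)"
      using C by auto
    ultimately show ?thesis
      unfolding borel_Sigma_gt_one[OF \<alpha>] by blast
  qed
qed

lemma borel_Pi_vimage:
  fixes f :: "'a :: topological_space \<Rightarrow> 'b :: topological_space"
  assumes "continuous_on UNIV f" "B \<in> borel_Pi \<alpha>"
  shows "f -` B \<in> borel_Pi \<alpha>"
  using borel_Sigma_vimage[OF assms(1), of "- B" \<alpha>] assms(2) by (simp add: borel_Pi_iff vimage_Compl)

lemma borel_Sigma_subset_borel:
  fixes B :: "'a :: topological_space set"
  shows "B \<in> borel_Sigma \<alpha> \<Longrightarrow> B \<in> sets borel"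
proof (induction \<alpha> arbitrary: B rule: less_induct)
  case (less \<alpha>)
  show ?case
  proof (cases "\<alpha> \<le> 1")
    case True
    with less.prems show ?thesis
      by (simp add: borel_Sigma.simps)
  next
    case False
    then have \<alpha>: "1 < \<alpha>" by simp
    obtain C where C: "B = \<Union>C" "countable C" "C \<subseteq> (\<Union>\<beta>\<in>{1..<\<alpha>}. borel_Pi \<beta>)"
      using less.prems unfolding borel_Sigma_gt_one[OF \<alpha>] by blast
    have "D \<in> sets borel" if "\<beta> < \<alpha>" "D \<in> borel_Pi \<beta>" for \<beta> and D :: "'a set"
      using borel_comp[OF less.IH[OF that(1), of "- D"]] that(2) by (simp add: borel_Pi_iff)
    then have "C \<subseteq> sets borel"
      using C(3) by fastforce
    then show ?thesis
      unfolding C(1) by (rule sets.countable_Union[OF C(2)])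
  qed
qed

section \<open>The hierarchy over a generating family and its duality\<close>

lemma Sigma_level_zero: "Sigma_level R 0 = boolean_combinations R"
  by (subst Sigma_level.simps) simp

lemma Pi_level_zero: "Pi_level R 0 = boolean_combinations R"
  by (subst Pi_level.simps) simp

lemma Sigma_level_pos:
  assumes "\<alpha> \<noteq> 0"
  shows "Sigma_level R \<alpha> = {\<Union>C | C. countable C \<and> C \<subseteq> (\<Union>\<beta>\<in>{..<\<alpha>}. Pi_level R \<beta>)}"
  using assms by (subst Sigma_level.simps) simp

lemma Pi_level_pos:
  assumes "\<alpha> \<noteq> 0"
  shows "Pi_level R \<alpha> = {\<Inter>C | C. countable C \<and> C \<subseteq> (\<Union>\<beta>\<in>{..<\<alpha>}. Sigma_level R \<beta>)}"
  using assms by (subst Pi_level.simps) simp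

lemma boolean_combinations_Compl_iff:
  "- S \<in> boolean_combinations R \<longleftrightarrow> S \<in> boolean_combinations R"
  using boolean_combinations.compl[of S R] boolean_combinations.compl[of "- S" R] by auto

text \<open>\<open>Pi_level\<close> has its own recursion with intersections, while
  \<open>borel_Pi\<close> consists of complements; De Morgan brings both to the same shape. Level 0
  is covered because Boolean combinations are closed under complement.\<close>

lemma Pi_level_iff: "S \<in> Pi_level R \<alpha> \<longleftrightarrow> - S \<in> Sigma_level R \<alpha>"
proof (induction \<alpha> arbitrary: S rule: less_induct)
  case (less \<alpha>)
  show ?case
  proof (cases "\<alpha> = 0")
    case True
    then show ?thesis
      by (simp add: Sigma_level_zero Pi_level_zero boolean_combinations_Compl_iff)
  next
    case False
    have IH: "- D \<in> Sigma_level R \<beta> \<longleftrightarrow> D \<in> Pi_level R \<beta>"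
      "- D \<in> Pi_level R \<beta> \<longleftrightarrow> D \<in> Sigma_level R \<beta>" if "\<beta> < \<alpha>" for \<beta> D
      using less[OF that, of D] less[OF that, of "- D"] by auto
    show ?thesis
    proof
      assume "S \<in> Pi_level R \<alpha>"
      then obtain C where C: "S = \<Inter>C" "countable C" "C \<subseteq> (\<Union>\<beta>\<in>{..<\<alpha>}. Sigma_level R \<beta>)"
        unfolding Pi_level_pos[OF False] by blast
      have "- S = \<Union>(uminus ` C)" "countable (uminus ` C)"
        "uminus ` C \<subseteq> (\<Union>\<beta>\<in>{..<\<alpha>}. Pi_level R \<beta>)"
        using C IH by (auto simp: subset_iff)
      then show "- S \<in> Sigma_level R \<alpha>"
        unfolding Sigma_level_pos[OF False] by blast
    next
      assume "- S \<in> Sigma_level R \<alpha>"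
      then obtain C where C: "- S = \<Union>C" "countable C" "C \<subseteq> (\<Union>\<beta>\<in>{..<\<alpha>}. Pi_level R \<beta>)"
        unfolding Sigma_level_pos[OF False] by blast
      have "S = - \<Union>C" using C(1) by auto
      then have "S = \<Inter>(uminus ` C)" by auto
      moreover have "countable (uminus ` C)" "uminus ` C \<subseteq> (\<Union>\<beta>\<in>{..<\<alpha>}. Sigma_level R \<beta>)"
        using C IH by (auto simp: subset_iff)
      ultimately show "S \<in> Pi_level R \<alpha>"
        unfolding Pi_level_pos[OF False] by blast
    qed
  qed
qed

section \<open>Preimages under squares of maps\<close>

text \<open>The map \<open>h\<close> may vary with the set, so unions and intersections of such
  preimages require a common \<open>h\<close> first.\<close>

definition square_preimages :: "(cantor \<times> cantor) set set \<Rightarrow> (cantor \<times> cantor) set set" where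
  "square_preimages \<B> = {map_prod h h -` B | h B. B \<in> \<B>}"

text \<open>The closure needed for a change of map: if k = p o h with p continuous, the preimage of
  B under k x k is the preimage under h x h of a set still in the family.\<close>

definition stable :: "(cantor \<times> cantor) set set \<Rightarrow> bool" where
  "stable \<B> \<longleftrightarrow> (\<forall>B\<in>\<B>. \<forall>p. continuous_on UNIV p \<longrightarrow> map_prod p p -` B \<in> \<B>)"

lemma square_preimagesI: "B \<in> \<B> \<Longrightarrow> map_prod h h -` B \<in> square_preimages \<B>"
  unfolding square_preimages_def by blast

lemma square_preimages_mono: "\<A> \<subseteq> \<B> \<Longrightarrow> square_preimages \<A> \<subseteq> square_preimages \<B>"
  unfolding square_preimages_def by blast

lemma square_preimages_Compl:
  assumes "- S \<in> square_preimages \<B>"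
  shows "S \<in> square_preimages {B. - B \<in> \<B>}"
proof -
  obtain h B where "- S = map_prod h h -` B" "B \<in> \<B>"
    using assms unfolding square_preimages_def by blast
  then have "S = map_prod h h -` (- B)" "- B \<in> {B. - B \<in> \<B>}"
    by (auto simp: vimage_Compl)
  then show ?thesis
    unfolding square_preimages_def by blast
qed

lemma stable_borel_Sigma: "stable (borel_Sigma \<alpha>)"
  unfolding stable_def by (blast intro: borel_Sigma_vimage continuous_map_prod)

lemma stable_borel_Pi: "stable (borel_Pi \<alpha>)"
  unfolding stable_def by (blast intro: borel_Pi_vimage continuous_map_prod)

lemma stable_UN: "(\<And>i. i \<in> I \<Longrightarrow> stable (\<B> i)) \<Longrightarrow> stable (\<Union>i\<in>I. \<B> i)"
  unfolding stable_def by blast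

lemma stable_clopen: "stable {B. open B \<and> closed B}"
  unfolding stable_def by (blast intro: open_vimage closed_vimage continuous_map_prod)

lemma stable_sets_borel: "stable (sets borel)"
  unfolding stable_def
proof (intro ballI allI impI)
  fix B :: "(cantor \<times> cantor) set" and p :: "cantor \<Rightarrow> cantor"
  assume B: "B \<in> sets borel" and p: "continuous_on UNIV p"
  have "map_prod p p \<in> borel_measurable borel"
    by (intro borel_measurable_continuous_onI continuous_map_prod p)
  from measurable_sets[OF this B] show "map_prod p p -` B \<in> sets borel" by simp
qed

text \<open>With \<open>h x\<close> merging all the values \<open>k n x\<close>, each
  \<open>k n\<close> is \<open>proj n\<close> after \<open>h\<close>. Stability absorbs the square
  of \<open>proj n\<close> into the target set.\<close>

lemma square_preimages_common:
  fixes S :: "nat \<Rightarrow> (cantor \<times> cantor) set"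
  assumes "stable \<B>" and "\<And>n. S n \<in> square_preimages \<B>"
  shows "\<exists>h B. (\<forall>n. B n \<in> \<B>) \<and> (\<forall>n. S n = map_prod h h -` B n)"
proof -
  obtain k D where D: "\<And>n. D n \<in> \<B>" "\<And>n. S n = map_prod (k n) (k n) -` D n"
    using assms(2) unfolding square_preimages_def mem_Collect_eq by metis
  define h where "h x = merge (\<lambda>n. k n x)" for x
  define B where "B n = map_prod (proj n) (proj n) -` D n" for n
  have "B n \<in> \<B>" for n
    using assms(1) D(1) continuous_proj unfolding stable_def B_def by blast
  moreover have "S n = map_prod h h -` B n" for n
    by (auto simp: D(2) B_def h_def)
  ultimately show ?thesis by blast
qed

text \<open>The union of \<open>D\<close> is not claimed to lie in \<B>: when \<B> collects lower
  levels, this union is what reaches the \<Sigma> level above them.\<close>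

lemma square_preimages_countable:
  assumes "stable \<B>" "countable C" "C \<subseteq> square_preimages \<B>"
  shows "\<exists>h D. countable D \<and> D \<subseteq> \<B> \<and> \<Union>C = map_prod h h -` \<Union>D"
proof (cases "C = {}")
  case True
  \<comment> \<open>\<open>from_nat_into\<close> enumerates only nonempty families; for the empty
    one any map serves.\<close>
  then show ?thesis by (intro exI[of _ undefined] exI[of _ "{}"]) auto
next
  case False
  have C: "from_nat_into C n \<in> square_preimages \<B>" for n
    using from_nat_into[OF False] assms(3) by blast
  obtain h B where B: "\<And>n. B n \<in> \<B>" "\<And>n. from_nat_into C n = map_prod h h -` B n"
    using square_preimages_common[where S = "from_nat_into C", OF assms(1) C] by metis
  have "\<Union>C = (\<Union>n. from_nat_into C n)"
    using range_from_nat_into[OF False assms(2)] by auto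
  also have "\<dots> = map_prod h h -` \<Union>(range B)"
    by (simp add: B(2) vimage_Union)
  finally show ?thesis
    using B(1) by (intro exI[of _ h] exI[of _ "range B"]) auto
qed

lemma square_preimages_two:
  assumes "stable \<B>" "S \<in> square_preimages \<B>" "T \<in> square_preimages \<B>"
  shows "\<exists>h. \<exists>B\<in>\<B>. \<exists>D\<in>\<B>. S = map_prod h h -` B \<and> T = map_prod h h -` D"
proof -
  have ST: "(if n = 0 then S else T) \<in> square_preimages \<B>" for n :: nat
    using assms by simp
  obtain h B where B: "\<And>n. B n \<in> \<B>" "\<And>n :: nat. (if n = 0 then S else T) = map_prod h h -` B n"
    using square_preimages_common[where S = "\<lambda>n. if n = 0 then S else T", OF assms(1) ST] by metis
  have "S = map_prod h h -` B 0" "T = map_prod h h -` B 1"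
    using B(2)[of 0] B(2)[of 1] by simp_all
  with B(1) show ?thesis by blast
qed

section \<open>Abstract rectangles as preimages\<close>

lemma abstract_rectangles_vimage:
  assumes "S \<in> abstract_rectangles"
  shows "map_prod f g -` S \<in> abstract_rectangles"
proof -
  obtain A B where "S = A \<times> B"
    using assms unfolding abstract_rectangles_def by blast
  then have "map_prod f g -` S = (f -` A) \<times> (g -` B)"
    by auto
  then show ?thesis
    unfolding abstract_rectangles_def by blast
qed

text \<open>One map must serve both coordinates: \<open>h x\<close> stores membership in A in digit
  0 and membership in B in the other digits, and \<open>D\<close> reads digit 0 on the left and
  digit 1 on the right. Only two digits are read, so \<open>D\<close> is clopen.\<close>

lemma abstract_rectangle_square_preimage:
  assumes "S \<in> abstract_rectangles"
  shows "S \<in> square_preimages {B. open B \<and> closed B}"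
proof -
  obtain A B where S: "S = A \<times> B"
    using assms unfolding abstract_rectangles_def by blast
  define h :: "cantor \<Rightarrow> cantor" where "h x = (\<lambda>n. if n = 0 then x \<in> A else x \<in> B)" for x
  define D :: "(cantor \<times> cantor) set" where "D = {u. u 0} \<times> {v. v 1}"
  have cont: "continuous_on UNIV (\<lambda>u :: cantor. u n)" for n
    by (rule continuous_on_product_coordinates)
  have "{u :: cantor. u n} = (\<lambda>u. u n) -` {True}" for n
    by auto
  then have "open {u :: cantor. u n}" "closed {u :: cantor. u n}" for n
    using open_vimage[OF open_discrete cont] closed_vimage[OF closed_singleton cont] by metis+
  then have "open D" "closed D"
    unfolding D_def by (auto intro: open_Times closed_Times)
  moreover have "S = map_prod h h -` D"
    by (auto simp: S D_def h_def)
  ultimately show ?thesis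
    using square_preimagesI[of D _ h] by simp
qed

text \<open>Clopen sets are a Boolean algebra, so the target stays clopen. Being open serves level 1
  later, being closed serves the levels above it.\<close>

lemma boolean_combination_square_preimage:
  "S \<in> boolean_combinations abstract_rectangles \<Longrightarrow> S \<in> square_preimages {B. open B \<and> closed B}"
proof (induction rule: boolean_combinations.induct)
  case (base S)
  then show ?case by (rule abstract_rectangle_square_preimage)
next
  case (compl S)
  have "{B :: (cantor \<times> cantor) set. - B \<in> {B. open B \<and> closed B}} = {B. open B \<and> closed B}"
    by (auto simp: closed_def)
  then show ?case
    using square_preimages_Compl[of "- S" "{B. open B \<and> closed B}"] compl.IH by simp
next
  case (union S T)
  obtain h :: "cantor \<Rightarrow> cantor" and B D
    where "B \<in> {B. open B \<and> closed B}" "D \<in> {B. open B \<and> closed B}"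
      "S = map_prod h h -` B" "T = map_prod h h -` D"
    using square_preimages_two[OF stable_clopen union.IH] by blast
  then have "S \<union> T = map_prod h h -` (B \<union> D)" "B \<union> D \<in> {B. open B \<and> closed B}"
    by auto
  then show ?case using square_preimagesI by metis
next
  case (inter S T)
  obtain h :: "cantor \<Rightarrow> cantor" and B D
    where "B \<in> {B. open B \<and> closed B}" "D \<in> {B. open B \<and> closed B}"
      "S = map_prod h h -` B" "T = map_prod h h -` D"
    using square_preimages_two[OF stable_clopen inter.IH] by blast
  then have "S \<inter> T = map_prod h h -` (B \<inter> D)" "B \<inter> D \<in> {B. open B \<and> closed B}"
    by auto
  then show ?case using square_preimagesI by metis
qed

section \<open>Matching the levels of the two hierarchies\<close>

lemma open_as_countable_union_rectangles:
  fixes U :: "(cantor \<times> cantor) set"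
  assumes "open U"
  obtains C where "countable C" "C \<subseteq> abstract_rectangles" "U = \<Union>C"
proof -
  obtain \<B> :: "cantor set set" where \<B>: "countable \<B>" "topological_basis \<B>"
    using ex_countable_basis by blast
  have "\<forall>U. open U \<longrightarrow> (\<exists>C\<subseteq>(\<lambda>(a, b). a \<times> b) ` (\<B> \<times> \<B>). \<Union>C = U)"
    using topological_basis_prod[OF \<B>(2) \<B>(2)] unfolding topological_basis_def by (rule conjunct2)
  with assms obtain C where C: "C \<subseteq> (\<lambda>(a, b). a \<times> b) ` (\<B> \<times> \<B>)" "\<Union>C = U"
    by metis
  show ?thesis
  proof (rule that)
    show "countable C"
      by (rule countable_subset[OF C(1)]) (intro countable_image countable_SIGMA \<B>(1))
    show "C \<subseteq> abstract_rectangles"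
      by (rule subset_trans[OF C(1)]) (auto simp: abstract_rectangles_def)
  qed (use C in simp)
qed

text \<open>Preimages commute with unions and complements, so the substance is at level 1: an open
  set is a countable union of rectangles, and a rectangle pulled back under g x g is a rectangle, of
  level 0.\<close>

lemma square_preimage_Sigma_level:
  fixes B :: "(cantor \<times> cantor) set"
  assumes "1 \<le> \<alpha>" "B \<in> borel_Sigma \<alpha>"
  shows "map_prod g g -` B \<in> Sigma_level abstract_rectangles \<alpha>"
  using assms
proof (induction \<alpha> arbitrary: B rule: less_induct)
  case (less \<alpha>)
  have nz: "\<alpha> \<noteq> 0" using less.prems one_le_omega1_iff by blast
  \<comment> \<open>Both cases supply a countable decomposition of B whose pieces pull back below
    \<alpha>: rectangles when \<alpha> = 1, sets from lower \<open>borel_Pi\<close> levels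
    otherwise.\<close>
  have "\<exists>C. countable C \<and> B = \<Union>C \<and>
      (\<forall>D\<in>C. map_prod g g -` D \<in> (\<Union>\<beta>\<in>{..<\<alpha>}. Pi_level abstract_rectangles \<beta>))"
  proof (cases "\<alpha> = 1")
    case True
    then have "open B" using less.prems by (simp add: borel_Sigma_one)
    then obtain C where C: "countable C" "C \<subseteq> abstract_rectangles" "B = \<Union>C"
      by (rule open_as_countable_union_rectangles)
    have "map_prod g g -` D \<in> Pi_level abstract_rectangles 0" if "D \<in> C" for D
      unfolding Pi_level_zero
      using that C(2) by (auto intro: boolean_combinations.base abstract_rectangles_vimage)
    moreover have "0 < \<alpha>" using True less_one_omega1_iff by simp
    ultimately show ?thesis using C by blast
  next
    case False
    then have \<alpha>: "1 < \<alpha>" using less.prems by simp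
    obtain C where C: "B = \<Union>C" "countable C" "C \<subseteq> (\<Union>\<beta>\<in>{1..<\<alpha>}. borel_Pi \<beta>)"
      using less.prems unfolding borel_Sigma_gt_one[OF \<alpha>] by blast
    have "map_prod g g -` D \<in> Pi_level abstract_rectangles \<beta>"
      if "\<beta> < \<alpha>" "1 \<le> \<beta>" "D \<in> borel_Pi \<beta>" for \<beta> D
      using less.IH[OF that(1,2), of "- D"] that(3)
      by (simp add: borel_Pi_iff Pi_level_iff vimage_Compl)
    then have "\<forall>D\<in>C. map_prod g g -` D \<in> (\<Union>\<beta>\<in>{..<\<alpha>}. Pi_level abstract_rectangles \<beta>)"
      using C(3) by fastforce
    with C show ?thesis by blast
  qed
  then obtain C where C: "countable C" "B = \<Union>C"
    "\<forall>D\<in>C. map_prod g g -` D \<in> (\<Union>\<beta>\<in>{..<\<alpha>}. Pi_level abstract_rectangles \<beta>)"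
    by blast
  let ?C = "vimage (map_prod g g) ` C"
  have "map_prod g g -` B = \<Union>?C" "countable ?C"
    "?C \<subseteq> (\<Union>\<beta>\<in>{..<\<alpha>}. Pi_level abstract_rectangles \<beta>)"
    using C by auto
  then show ?case
    unfolding Sigma_level_pos[OF nz] by blast
qed

text \<open>Level 0 over the rectangles has no counterpart in the Borel hierarchy, which begins at
  1; clopen sets stand in for it. Countable unions are handled by passing to a common map.\<close>

lemma Sigma_level_square_preimage:
  assumes "1 \<le> \<alpha>" "S \<in> Sigma_level abstract_rectangles \<alpha>"
  shows "S \<in> square_preimages (borel_Sigma \<alpha>)"
  using assms
proof (induction \<alpha> arbitrary: S rule: less_induct)
  case (less \<alpha>)
  have nz: "\<alpha> \<noteq> 0" using less.prems one_le_omega1_iff by blast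
  obtain C where C: "S = \<Union>C" "countable C" "C \<subseteq> (\<Union>\<beta>\<in>{..<\<alpha>}. Pi_level abstract_rectangles \<beta>)"
    using less.prems unfolding Sigma_level_pos[OF nz] by blast
  have zero: "T \<in> square_preimages {B. open B \<and> closed B}" if "T \<in> Pi_level abstract_rectangles 0" for T
    using that boolean_combination_square_preimage by (simp add: Pi_level_zero)
  show ?case
  proof (cases "\<alpha> = 1")
    case True
    then have "{..<\<alpha>} = {0}" by (simp add: lessThan_def less_one_omega1_iff)
    then have "C \<subseteq> square_preimages {B. open B \<and> closed B}"
      using C(3) zero by auto
    from square_preimages_countable[OF stable_clopen C(2) this] obtain h :: "cantor \<Rightarrow> cantor" and D
      where D: "D \<subseteq> {B. open B \<and> closed B}" "\<Union>C = map_prod h h -` \<Union>D"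
      by (elim exE conjE) (rule that)
    have "\<Union>D \<in> borel_Sigma \<alpha>"
      using D(1) unfolding True borel_Sigma_one by auto
    then show ?thesis
      unfolding C(1) D(2) by (rule square_preimagesI)
  next
    case False
    then have \<alpha>: "1 < \<alpha>" using less.prems by simp
    \<comment> \<open>The pieces of S may sit at different levels below \<alpha>, so these levels
      are pooled in one stable family before a common map is chosen.\<close>
    let ?\<B> = "\<Union>\<beta>\<in>{1..<\<alpha>}. borel_Pi \<beta> :: (cantor \<times> cantor) set set"
    have "T \<in> square_preimages ?\<B>" if "\<beta> < \<alpha>" "T \<in> Pi_level abstract_rectangles \<beta>" for \<beta> T
    proof (cases "\<beta> = 0")
      case True
      \<comment> \<open>Clopen sets enter as closed sets, at level 1, which is below \<alpha> in
        this case.\<close>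
      have "{B. open B \<and> closed B} \<subseteq> ?\<B>"
      proof
        fix B :: "(cantor \<times> cantor) set"
        assume "B \<in> {B. open B \<and> closed B}"
        then have "B \<in> borel_Pi 1"
          by (simp add: borel_Pi_iff borel_Sigma_one closed_def)
        moreover have "1 \<in> {1..<\<alpha>}" using \<alpha> by simp
        ultimately show "B \<in> ?\<B>" by blast
      qed
      then show ?thesis
        using square_preimages_mono zero that(2) True by blast
    next
      case False
      then have \<beta>: "1 \<le> \<beta>" by (simp add: one_le_omega1_iff)
      have "- T \<in> square_preimages (borel_Sigma \<beta>)"
        using less.IH[OF that(1) \<beta>] that(2) by (simp add: Pi_level_iff)
      then have "T \<in> square_preimages (borel_Pi \<beta>)"
        using square_preimages_Compl[of T "borel_Sigma \<beta>"] by (simp add: borel_Pi.simps)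
      moreover have "borel_Pi \<beta> \<subseteq> ?\<B>"
        using \<beta> that(1) by auto
      ultimately show ?thesis
        using square_preimages_mono by blast
    qed
    then have "C \<subseteq> square_preimages ?\<B>"
      using C(3) by blast
    from square_preimages_countable[OF stable_UN[OF stable_borel_Pi] C(2) this]
    obtain h :: "cantor \<Rightarrow> cantor" and D
      where D: "countable D" "D \<subseteq> ?\<B>" "\<Union>C = map_prod h h -` \<Union>D"
      by (elim exE conjE) (rule that)
    have "\<Union>D \<in> borel_Sigma \<alpha>"
      using D(1,2) unfolding borel_Sigma_gt_one[OF \<alpha>] by blast
    then show ?thesis
      unfolding C(1) D(3) by (rule square_preimagesI)
  qed
qed

section \<open>The same correspondence for the generated \<sigma>-algebra and the Borel sets\<close>

lemma square_preimage_sigma_sets: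
  fixes B :: "(cantor \<times> cantor) set"
  assumes "B \<in> sets borel"
  shows "map_prod g g -` B \<in> sigma_sets UNIV abstract_rectangles"
proof -
  have "B \<in> sigma_sets UNIV {S. open S}"
    using assms by (simp add: borel_def)
  then show ?thesis
  proof (induction rule: sigma_sets.induct)
    case (Basic U)
    then have "open U" by simp
    then obtain C where C: "countable C" "C \<subseteq> abstract_rectangles" "U = \<Union>C"
      by (rule open_as_countable_union_rectangles)
    have "countable (vimage (map_prod g g) ` C)"
      "vimage (map_prod g g) ` C \<subseteq> sigma_sets UNIV abstract_rectangles"
      using C abstract_rectangles_vimage by (auto intro: sigma_sets.Basic)
    then have "\<Union>(vimage (map_prod g g) ` C) \<in> sigma_sets UNIV abstract_rectangles"
      by (intro sigma_sets_UNION) auto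
    then show ?case by (simp add: C(3) vimage_Union)
  next
    case Empty
    then show ?case by (simp add: sigma_sets.Empty)
  next
    case (Compl B)
    from sigma_sets.Compl[OF Compl.IH] show ?case
      by (simp add: vimage_Diff)
  next
    case (Union B)
    from sigma_sets.Union[OF Union.IH] show ?case
      by (simp add: vimage_UN)
  qed
qed

text \<open>Once a common map is found, a countable union stays in the same family, as the Borel
  sets are closed under it; no levels have to be tracked.\<close>

lemma sigma_sets_square_preimage:
  "S \<in> sigma_sets UNIV abstract_rectangles \<Longrightarrow> S \<in> square_preimages (sets borel)"
proof (induction rule: sigma_sets.induct)
  case (Basic S)
  have "{B :: (cantor \<times> cantor) set. open B \<and> closed B} \<subseteq> sets borel" by auto
  then show ?case
    using abstract_rectangle_square_preimage[OF Basic] square_preimages_mono by blast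
next
  case Empty
  then show ?case using square_preimagesI[of "{}" "sets borel" undefined] by simp
next
  case (Compl S)
  have "{B :: (cantor \<times> cantor) set. - B \<in> sets borel} = sets borel"
    using borel_comp by fastforce
  then show ?case
    unfolding Compl_eq_Diff_UNIV[symmetric]
    using square_preimages_Compl[of "- S" "sets borel"] Compl.IH by simp
next
  case (Union S)
  obtain h :: "cantor \<Rightarrow> cantor" and B :: "nat \<Rightarrow> (cantor \<times> cantor) set"
    where "\<And>n. B n \<in> sets borel" "\<And>n. S n = map_prod h h -` B n"
    using square_preimages_common[where S = S, OF stable_sets_borel Union.IH] by metis
  then have "(\<Union>n. B n) \<in> sets borel" "(\<Union>n. S n) = map_prod h h -` (\<Union>n. B n)"
    by auto
  then show ?case using square_preimagesI by metis
qed

section \<open>Universal functions\<close>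

text \<open>The exponential unfolds to all functions from \<nat> to \<open>bool\<close>, that is, to
  the points themselves; the canonical well-order of \<open>cantor\<close> thus has the order type
  of the continuum.\<close>

lemma continuum_eq: "continuum = |UNIV :: cantor set|"
  by (simp add: continuum_def cexp_def ctwo_def Field_natLeq Field_card_of Func_def)

text \<open>Along a well-order of type $\mathfrak c$, the point \<open>g x\<close> records \<open>x\<close> and the values of \<open>G\<close> at
  \<open>(x, y)\<close> and \<open>(y, x)\<close> for all \<open>y \<le> x\<close>. Each digit of these values is a subset of the segment below \<open>x\<close>,
  and there are at most $\mathfrak c$ such subsets.\<close>

lemma ex_universal:
  assumes "is_two_power_below continuum continuum"
  shows "\<exists>F :: cantor \<times> cantor \<Rightarrow> cantor. universal F"
proof -
  define r where "r = |UNIV :: cantor set|"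
  have total: "x \<in> underS r y \<or> y \<in> underS r x" if "x \<noteq> y" for x y
  proof -
    have "total_on UNIV r"
      using card_of_Well_order[of "UNIV :: cantor set"]
      by (simp add: r_def well_order_on_def linear_order_on_def Field_card_of)
    then show ?thesis
      using that by (auto simp: total_on_def underS_def)
  qed
  have asym: "x \<notin> underS r y" if "y \<in> underS r x" for x y
  proof -
    have "antisym r"
      using card_of_Well_order[of "UNIV :: cantor set"]
      by (simp add: r_def well_order_on_def linear_order_on_def partial_order_on_def)
    then show ?thesis
      using that by (auto simp: underS_def dest: antisymD)
  qed
  have "\<exists>e :: cantor set \<Rightarrow> cantor. inj_on e (Pow (underS r x))" for x
  proof -
    \<comment> \<open>A cardinal is an initial ordinal, so its proper segments are smaller.\<close>
    have "|underS r x| <o continuum"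
      unfolding continuum_eq r_def
      by (rule card_of_underS[OF card_of_Card_order]) (simp add: Field_card_of)
    \<comment> \<open>The hypothesis is applied with \<lambda> the size of the segment; subsets of
      the segment can then be coded by points.\<close>
    then have "ctwo ^c |underS r x| \<le>o continuum"
      using assms card_of_Card_order unfolding is_two_power_below_def by blast
    moreover have "ctwo ^c |underS r x| = |Func (underS r x) (UNIV :: bool set)|"
      by (simp add: cexp_def ctwo_def Field_card_of)
    ultimately have "|Pow (underS r x)| \<le>o |UNIV :: cantor set|"
      using card_of_Pow_Func ordIso_ordLeq_trans unfolding continuum_eq by metis
    then show ?thesis
      by (simp flip: card_of_ordLeq)
  qed
  then obtain e :: "cantor \<Rightarrow> cantor set \<Rightarrow> cantor" where e: "\<And>x. inj_on (e x) (Pow (underS r x))"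
    by metis
  define dec where "dec x = inv_into (Pow (underS r x)) (e x)" for x
  have dec: "dec x (e x {y \<in> underS r x. P y}) = {y \<in> underS r x. P y}" for x P
    unfolding dec_def by (rule inv_into_f_f[OF e]) auto
  \<comment> \<open>Component 0 names the point, so \<open>F\<close> sees which argument is later
    and consults that one: component 2 codes G (x, y) and component 3 codes G (y, x) for y before x.
    Component 1 holds the diagonal value. Digit n asks whether the earlier point lies in the decoded
    set.\<close>
  define F :: "cantor \<times> cantor \<Rightarrow> cantor" where
    "F = (\<lambda>(u, v). let x = proj 0 u; y = proj 0 v in
       if y \<in> underS r x then \<lambda>n. y \<in> dec x (proj n (proj 2 u))
       else if x \<in> underS r y then \<lambda>n. x \<in> dec y (proj n (proj 3 v))
       else proj 1 u)"
  have "\<exists>g. \<forall>x y. G (x, y) = F (g x, g y)" for G :: "cantor \<times> cantor \<Rightarrow> cantor"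
  proof -
    define g where "g x = merge (\<lambda>i. if i = 0 then x else if i = 1 then G (x, x)
        else if i = 2 then merge (\<lambda>n. e x {y \<in> underS r x. G (x, y) n})
        else merge (\<lambda>n. e x {y \<in> underS r x. G (y, x) n}))" for x
    have "G (x, y) = F (g x, g y)" for x y
    proof -
      consider "x = y" | "y \<in> underS r x" | "x \<in> underS r y"
        using total by blast
      then show ?thesis
      proof cases
        case 1
        then show ?thesis by (simp add: F_def g_def Let_def underS_notIn)
      next
        case 2
        then show ?thesis by (simp add: F_def g_def Let_def dec)
      next
        case 3
        \<comment> \<open>The first test in \<open>F\<close> must fail here, which
          \<open>asym\<close> ensures.\<close>
        then show ?thesis using asym[OF 3] by (simp add: F_def g_def Let_def dec)
      qed
    qed
    then show ?thesis by blast
  qed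
  then show ?thesis
    unfolding universal_def by blast
qed

section \<open>Borel functions by digits, and the passage between universal functions and square
  preimages\<close>

lemma borel_measurable_cantor_iff:
  fixes F :: "'a \<Rightarrow> cantor"
  shows "F \<in> borel_measurable M \<longleftrightarrow> (\<forall>n. {x \<in> space M. F x n} \<in> sets M)"
proof
  assume F: "F \<in> borel_measurable M"
  show "\<forall>n. {x \<in> space M. F x n} \<in> sets M"
  proof
    fix n
    have "(\<lambda>x. F x n) \<in> borel_measurable M"
      using F by (rule measurable_compose) (intro borel_measurable_continuous_onI continuous_on_product_coordinates)
    then have "(\<lambda>x. F x n) -` {True} \<inter> space M \<in> sets M"
      by (rule measurable_sets) simp
    moreover have "(\<lambda>x. F x n) -` {True} \<inter> space M = {x \<in> space M. F x n}"
      by auto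
    ultimately show "{x \<in> space M. F x n} \<in> sets M" by simp
  qed
next
  assume F: "\<forall>n. {x \<in> space M. F x n} \<in> sets M"
  have "(\<lambda>x. F x n) \<in> measurable M (count_space UNIV)" for n
    using F by (simp add: pred_def)
  then have "(\<lambda>x. F x n) \<in> borel_measurable M" for n
    by (rule measurable_compose) (simp add: borel_measurable_continuous_onI)
  then show "F \<in> borel_measurable M"
    by (intro measurable_coordinatewise_then_product)
qed

lemma at_level_iff: "at_level \<alpha> F \<longleftrightarrow> (\<forall>n. {p. F p n} \<in> borel_Sigma \<alpha>)"
proof -
  have "{(u, v). F (u, v) n} = {p. F p n}" for n
    by auto
  then show ?thesis
    by (simp add: at_level_def)
qed

text \<open>Take for G the function sending p to the constant sequence with value the truth of p
  \<in> S: every digit of it decides membership in S, so any digit n of F will do.\<close>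

lemma universal_imp_square_preimage:
  fixes F :: "cantor \<times> cantor \<Rightarrow> cantor" and S :: "(cantor \<times> cantor) set"
  assumes "universal F"
  obtains g where "S = map_prod g g -` {p. F p n}"
proof -
  obtain g where "\<forall>x y. (\<lambda>_. (x, y) \<in> S) = F (g x, g y)"
    using assms[unfolded universal_def, rule_format, of "\<lambda>p _. p \<in> S"] by blast
  then have "(x, y) \<in> S \<longleftrightarrow> F (g x, g y) n" for x y
    by metis
  then have "S = map_prod g g -` {p. F p n}" by auto
  then show ?thesis by (rule that)
qed

text \<open>Universality passes from E to any F with E = F o (h x h): a G reduced to E by g is
  reduced to F by h o g. The sets \<open>B n\<close> supply the digits of such an F.\<close>

lemma square_preimages_imp_universal:
  assumes "is_two_power_below continuum continuum" "stable \<B>"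
    and all: "\<And>S. S \<in> square_preimages \<B>"
  shows "\<exists>F :: cantor \<times> cantor \<Rightarrow> cantor. universal F \<and> (\<forall>n. {p. F p n} \<in> \<B>)"
proof -
  obtain E :: "cantor \<times> cantor \<Rightarrow> cantor" where E: "universal E"
    using ex_universal[OF assms(1)] by blast
  obtain h B where B: "\<And>n. B n \<in> \<B>" "\<And>n. {p. E p n} = map_prod h h -` B n"
    using square_preimages_common[where S = "\<lambda>n. {p. E p n}", OF assms(2) all] by metis
  define F :: "cantor \<times> cantor \<Rightarrow> cantor" where "F p n \<longleftrightarrow> p \<in> B n" for p n
  have EF: "E (x, y) = F (h x, h y)" for x y
    using B(2) by (auto simp: F_def fun_eq_iff set_eq_iff)
  have "\<exists>g. \<forall>x y. G (x, y) = F (g x, g y)" for G :: "cantor \<times> cantor \<Rightarrow> cantor"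
  proof -
    obtain g where "\<forall>x y. G (x, y) = E (g x, g y)"
      using E unfolding universal_def by blast
    then show ?thesis
      by (intro exI[of _ "h \<circ> g"]) (simp add: EF)
  qed
  then have "universal F"
    unfolding universal_def by blast
  moreover have "{p. F p n} \<in> \<B>" for n
    using B(1)[of n] by (simp add: F_def)
  ultimately show ?thesis by blast
qed

theorem theorem2p4:
  assumes "is_two_power_below continuum continuum"
  shows "((\<exists>F :: cantor \<times> cantor \<Rightarrow> cantor. F \<in> borel_measurable borel \<and> universal F)
            \<longleftrightarrow> (\<forall>S :: (cantor \<times> cantor) set. S \<in> sigma_sets UNIV abstract_rectangles))
       \<and> (\<forall>\<alpha> :: omega1. 1 \<le> \<alpha> \<longrightarrow>
            (Pow (UNIV :: (cantor \<times> cantor) set) = Sigma_level abstract_rectangles \<alpha>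
              \<longleftrightarrow> (\<exists>F :: cantor \<times> cantor \<Rightarrow> cantor.
                     F \<in> borel_measurable borel \<and> universal F \<and> at_level \<alpha> F)))"
proof (intro conjI allI impI iffI)
  fix S :: "(cantor \<times> cantor) set"
  assume "\<exists>F :: cantor \<times> cantor \<Rightarrow> cantor. F \<in> borel_measurable borel \<and> universal F"
  then obtain F :: "cantor \<times> cantor \<Rightarrow> cantor" where F: "F \<in> borel_measurable borel" "universal F"
    by blast
  obtain g where "S = map_prod g g -` {p. F p 0}"
    by (rule universal_imp_square_preimage[OF F(2)])
  moreover have "{p. F p 0} \<in> sets borel"
    using F(1) by (simp add: borel_measurable_cantor_iff)
  ultimately show "S \<in> sigma_sets UNIV abstract_rectangles"
    by (simp only: square_preimage_sigma_sets)
next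
  assume "\<forall>S :: (cantor \<times> cantor) set. S \<in> sigma_sets UNIV abstract_rectangles"
  then have S: "S \<in> square_preimages (sets borel)" for S
    using sigma_sets_square_preimage by blast
  obtain F :: "cantor \<times> cantor \<Rightarrow> cantor"
    where "universal F" "\<And>n. {p. F p n} \<in> sets borel"
    using square_preimages_imp_universal[OF assms stable_sets_borel S] by blast
  then show "\<exists>F :: cantor \<times> cantor \<Rightarrow> cantor. F \<in> borel_measurable borel \<and> universal F"
    using borel_measurable_cantor_iff[of F borel] by auto
next
  fix \<alpha> :: omega1
  assume \<alpha>: "1 \<le> \<alpha>" and "Pow (UNIV :: (cantor \<times> cantor) set) = Sigma_level abstract_rectangles \<alpha>"
  then have S: "S \<in> square_preimages (borel_Sigma \<alpha>)" for S
    using Sigma_level_square_preimage[OF \<alpha>] by blast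
  obtain F :: "cantor \<times> cantor \<Rightarrow> cantor"
    where F: "universal F" "\<And>n. {p. F p n} \<in> borel_Sigma \<alpha>"
    using square_preimages_imp_universal[OF assms stable_borel_Sigma S] by blast
  \<comment> \<open>Each digit set is Borel because every \<Sigma> level consists of Borel sets, and
    the digits determine measurability.\<close>
  have "F \<in> borel_measurable borel"
    using borel_Sigma_subset_borel[OF F(2)] by (simp add: borel_measurable_cantor_iff)
  moreover have "at_level \<alpha> F"
    unfolding at_level_iff using F(2) by (rule allI)
  ultimately show "\<exists>F :: cantor \<times> cantor \<Rightarrow> cantor.
      F \<in> borel_measurable borel \<and> universal F \<and> at_level \<alpha> F"
    using F(1) by blast
next
  fix \<alpha> :: omega1
  assume \<alpha>: "1 \<le> \<alpha>" and "\<exists>F :: cantor \<times> cantor \<Rightarrow> cantor.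
      F \<in> borel_measurable borel \<and> universal F \<and> at_level \<alpha> F"
  then obtain F :: "cantor \<times> cantor \<Rightarrow> cantor" where F: "universal F" "at_level \<alpha> F"
    by blast
  have "S \<in> Sigma_level abstract_rectangles \<alpha>" for S
  proof -
    obtain g where "S = map_prod g g -` {p. F p 0}"
      by (rule universal_imp_square_preimage[OF F(1)])
    moreover have "{p. F p 0} \<in> borel_Sigma \<alpha>"
      using F(2) unfolding at_level_iff by blast
    ultimately show ?thesis
      by (simp only: square_preimage_Sigma_level[OF \<alpha>])
  qed
  then show "Pow (UNIV :: (cantor \<times> cantor) set) = Sigma_level abstract_rectangles \<alpha>"
    by blast
qed

end
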